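(* For every $\epsilon>0$, every prime $p$ and every non-empty $S\subset\mathbb{F}_p$ there exists $K$ such that for every positive integer $n$, every set of mod-$p$ conditions on $S^n$ can be internally $\epsilon$-approximated by a set of at most $K$ mod-$p$ conditions on $S^n$.
   Context: If $S\subset\mathbb{F}_p$, a mod-$p$ condition on $S^n$ is a pair $(\phi,E)$, where $\phi$ is the restriction to $S^n$ of a linear form $\mathbb{F}_p^n\to\mathbb{F}_p$ and $E\subset\mathbb{F}_p$. A point $x\in S^n$ satisfies $(\phi,E)$ if $\phi(x)\in E$. The satisfying set of a set $\mathcal{F}$ of conditions is the set of all $x\in S^n$ that satisfy every condition in $\mathcal{F}$. A set $\mathcal{G}$ of conditions on $S^n$ internally $\epsilon$-approximates a set $\mathcal{F}$ of conditions on $S^n$ if the satisfying set $U$ of $\mathcal{G}$ is contained in the satisfying set $V$ of $\mathcal{F}$ and $|V\setminus U|\le\epsilon|S^n|$. *)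

theory Defs
  imports Complex_Main "HOL-Library.FuncSet" "HOL-Number_Theory.Residues"
begin

text \<open>The field with \<open>p\<close> elements is \<^term>\<open>residue_ring (int p)\<close>, and the power \<open>S ^ n\<close> of a set \<open>S\<close>
  is \<^term>\<open>PiE {..<n} (\<lambda>_. S)\<close>, with coordinates indexed by \<open>0, \<dots>, n - 1\<close>.\<close>

abbreviation GFp :: "nat \<Rightarrow> int ring" where
  "GFp p \<equiv> residue_ring (int p)"

abbreviation set_power :: "'a set \<Rightarrow> nat \<Rightarrow> (nat \<Rightarrow> 'a) set" where
  "set_power S n \<equiv> {..<n} \<rightarrow>\<^sub>E S"

definition linear_form :: "('a, 'b) ring_scheme \<Rightarrow> nat \<Rightarrow> ((nat \<Rightarrow> 'a) \<Rightarrow> 'a) \<Rightarrow> bool" where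
  "linear_form R n \<psi> \<longleftrightarrow>
     \<psi> \<in> set_power (carrier R) n \<rightarrow> carrier R \<and>
     (\<forall>x \<in> set_power (carrier R) n. \<forall>y \<in> set_power (carrier R) n.
        \<psi> (\<lambda>i\<in>{..<n}. x i \<oplus>\<^bsub>R\<^esub> y i) = \<psi> x \<oplus>\<^bsub>R\<^esub> \<psi> y) \<and>
     (\<forall>c \<in> carrier R. \<forall>x \<in> set_power (carrier R) n.
        \<psi> (\<lambda>i\<in>{..<n}. c \<otimes>\<^bsub>R\<^esub> x i) = c \<otimes>\<^bsub>R\<^esub> \<psi> x)"

text \<open>The use of \<^const>\<open>restrict\<close> makes two linear forms that agree on \<open>S ^ n\<close> give the same
  condition, so that cardinalities of sets of conditions are the intended ones.\<close>

definition mod_p_conditions ::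
    "nat \<Rightarrow> int set \<Rightarrow> nat \<Rightarrow> (((nat \<Rightarrow> int) \<Rightarrow> int) \<times> int set) set" where
  "mod_p_conditions p S n =
     {(restrict \<psi> (set_power S n), E) | \<psi> E. linear_form (GFp p) n \<psi> \<and> E \<subseteq> carrier (GFp p)}"

definition satisfies :: "'x \<Rightarrow> ('x \<Rightarrow> 'a) \<times> 'a set \<Rightarrow> bool" where
  "satisfies x C \<longleftrightarrow> fst C x \<in> snd C"

definition satisfying_set ::
    "'a set \<Rightarrow> nat \<Rightarrow> (((nat \<Rightarrow> 'a) \<Rightarrow> 'a) \<times> 'a set) set \<Rightarrow> (nat \<Rightarrow> 'a) set" where
  "satisfying_set S n F = {x \<in> set_power S n. \<forall>C \<in> F. satisfies x C}"

definition internally_approximates ::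
    "'a set \<Rightarrow> nat \<Rightarrow> real \<Rightarrow> (((nat \<Rightarrow> 'a) \<Rightarrow> 'a) \<times> 'a set) set \<Rightarrow>
      (((nat \<Rightarrow> 'a) \<Rightarrow> 'a) \<times> 'a set) set \<Rightarrow> bool" where
  "internally_approximates S n \<epsilon> G F \<longleftrightarrow>
     satisfying_set S n G \<subseteq> satisfying_set S n F \<and>
     real (card (satisfying_set S n F - satisfying_set S n G)) \<le> \<epsilon> * real (card (set_power S n))"

end

theory Submission
  imports Defs "HOL-Library.Disjoint_Sets" "HOL-Library.Real_Mod"
begin

text \<open>
  \<^bold>\<open>Why the theorem holds.\<close> A linear form is given by its vector of coefficients, so conditions can
  be compared through the Hamming distance of their coefficient vectors. Approximations of finitely
  many subfamilies combine into an approximation of their union (\<open>approximable_partition\<close>), which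
  allows sorting conditions into boundedly many classes as often as one likes. Let \<open>|S| \<ge> 2\<close> and
  discard the conditions with \<open>E\<close> the whole field, which always hold.

  \<^emph>\<open>Many forms far apart.\<close> Suppose the family contains \<open>R\<close> forms such that all combinations
  \<open>u a - v b\<close> with \<open>u, v \<noteq> 0\<close>, apart from the zero ones \<open>u a - u a\<close>, have at least \<open>M\<close> nonzero
  coefficients. The characters \<open>x \<mapsto> e(u \<phi>(x) / p)\<close> are then almost orthogonal on \<open>S ^ n\<close>, because \<open>S\<close> has
  two elements and every nonzero coefficient contributes a factor \<open>\<theta> < 1\<close> to a correlation. A point that
  satisfies all conditions misses a value of each of the \<open>R\<close> forms, which makes a suitably twisted sum
  of these characters equal to \<open>- R\<close>. By the second moment there are few such points
  (\<open>card_avoid_values_le\<close>), and one condition that never holds is an internal approximation.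

  \<^emph>\<open>Few forms far apart.\<close> Otherwise a maximal family of forms that are far apart has fewer than \<open>R\<close>
  members, so every form is within distance \<open>M\<close> of one of boundedly many forms. It remains to treat the
  conditions \<open>(b + \<chi>, E)\<close> with \<open>b\<close> and \<open>E\<close> fixed and \<open>\<chi>\<close> having at most \<open>m\<close> nonzero coefficients
  (\<open>approximable_nearby_conditions\<close>), by induction on \<open>m\<close>. The set \<open>T\<close> of values of \<open>\<chi>\<close> on \<open>S ^ n\<close> may
  also be fixed. If many of the \<open>\<chi>\<close> have disjoint supports, then the single condition
  \<open>b(x) \<in> {c. c + T \<subseteq> E}\<close> is an internal approximation. It implies all the given conditions. Conversely,
  if it fails at \<open>x\<close>, some \<open>t \<in> T\<close> has \<open>b(x) + t \<notin> E\<close>, so a point satisfying the given conditions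
  has \<open>\<chi>(x) \<noteq> t\<close> for all those independent \<open>\<chi>\<close>, which is rare. If there are only few disjoint
  supports, then boundedly many coordinates meet all nonempty supports. Sorting by the coefficients on
  these coordinates and moving them into \<open>b\<close> decreases \<open>m\<close>.

  Projecting onto \<open>b\<close>, instead of selecting conditions from the family, is what makes the
  approximation internal.
\<close>

section \<open>Maximal families and combinatorics of product sets\<close>

text \<open>
  The dichotomy behind both halves of the argument: members are added greedily until there are \<open>N\<close> of
  them or nothing more fits.
\<close>

lemma pairwise_subset_or_maximal:
  assumes "symp R"
  shows "(\<exists>A\<subseteq>X. finite A \<and> card A = N \<and> pairwise R A) \<or>
         (\<exists>A\<subseteq>X. finite A \<and> card A < N \<and> pairwise R A \<and> (\<forall>x\<in>X. x \<in> A \<or> (\<exists>a\<in>A. \<not> R x a)))"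
proof (induction N)
  case 0
  then show ?case by (intro disjI1 exI[of _ "{}"]) auto
next
  case (Suc N)
  then consider (a) A where "A \<subseteq> X" "finite A" "card A = N" "pairwise R A"
    | (b) A where "A \<subseteq> X" "finite A" "card A < N" "pairwise R A" "\<forall>x\<in>X. x \<in> A \<or> (\<exists>a\<in>A. \<not> R x a)"
    by blast
  then show ?case
  proof cases
    case a
    show ?thesis
    proof (cases "\<forall>x\<in>X. x \<in> A \<or> (\<exists>a\<in>A. \<not> R x a)")
      case True
      with a show ?thesis by (intro disjI2 exI[of _ A]) auto
    next
      case False
      then obtain x where x: "x \<in> X" "x \<notin> A" "\<And>a. a \<in> A \<Longrightarrow> R x a" by blast
      with a assms show ?thesis
        by (intro disjI1 exI[of _ "insert x A"]) (auto simp: pairwise_insert symp_def)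
    qed
  next
    case b
    then show ?thesis by (intro disjI2 exI[of _ A]) auto
  qed
qed

text \<open>
  Events that depend on complementary sets of coordinates are independent: a point is determined by its
  two restrictions.
\<close>

lemma card_PiE_split_le:
  assumes "finite D" "finite S" "I \<subseteq> D"
    and Q: "\<And>x. x \<in> D \<rightarrow>\<^sub>E S \<Longrightarrow> Q x \<Longrightarrow> Q (restrict x I)"
    and R: "\<And>x. x \<in> D \<rightarrow>\<^sub>E S \<Longrightarrow> R x \<Longrightarrow> R (restrict x (D - I))"
  shows "card {x \<in> D \<rightarrow>\<^sub>E S. Q x \<and> R x} \<le> card {x \<in> I \<rightarrow>\<^sub>E S. Q x} * card {x \<in> (D - I) \<rightarrow>\<^sub>E S. R x}"
proof -
  let ?f = "\<lambda>x. (restrict x I, restrict x (D - I))"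
  have fin: "finite (A \<rightarrow>\<^sub>E S)" if "A \<subseteq> D" for A
    using that assms(1,2) by (intro finite_PiE) (auto intro: finite_subset)
  have "inj_on ?f {x \<in> D \<rightarrow>\<^sub>E S. Q x \<and> R x}"
  proof (rule inj_onI)
    fix x y assume x: "x \<in> {x \<in> D \<rightarrow>\<^sub>E S. Q x \<and> R x}" and y: "y \<in> {x \<in> D \<rightarrow>\<^sub>E S. Q x \<and> R x}"
      and e: "?f x = ?f y"
    show "x = y"
    proof (rule PiE_ext[of _ D "\<lambda>_. S"])
      fix i assume "i \<in> D"
      then show "x i = y i"
        using e by (cases "i \<in> I") (auto simp: restrict_def fun_eq_iff split: if_splits)
    qed (use x y in auto)
  qed
  moreover have "?f ` {x \<in> D \<rightarrow>\<^sub>E S. Q x \<and> R x} \<subseteq> {x \<in> I \<rightarrow>\<^sub>E S. Q x} \<times> {x \<in> (D - I) \<rightarrow>\<^sub>E S. R x}"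
    using Q R assms(3) by (auto simp: PiE_iff)
  ultimately have "card {x \<in> D \<rightarrow>\<^sub>E S. Q x \<and> R x} \<le> card ({x \<in> I \<rightarrow>\<^sub>E S. Q x} \<times> {x \<in> (D - I) \<rightarrow>\<^sub>E S. R x})"
    using fin assms(3) by (intro card_inj_on_le) auto
  then show ?thesis by (simp add: card_cartesian_product)
qed

text \<open>
  The index sets \<open>I a\<close> are disjoint, so a uniformly random point agrees with the patterns \<open>w a\<close>
  independently, each with probability at least \<open>1 / |S| ^ m\<close>.
\<close>

lemma card_avoid_patterns_le:
  fixes w :: "'b \<Rightarrow> 'i \<Rightarrow> 'a"
  assumes "finite D" "finite S" "S \<noteq> {}" "finite A"
    and "\<And>a. a \<in> A \<Longrightarrow> I a \<subseteq> D \<and> card (I a) \<le> m \<and> w a \<in> I a \<rightarrow> S"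
    and "disjoint_family_on I A"
  shows "real (card {x \<in> D \<rightarrow>\<^sub>E S. \<forall>a\<in>A. \<exists>i\<in>I a. x i \<noteq> w a i})
           \<le> (1 - 1 / real (card S) ^ m) ^ card A * real (card S) ^ card D"
  using assms(4,1,5,6)
proof (induction A arbitrary: D rule: finite_induct)
  case empty
  then show ?case by (simp add: card_funcsetE)
next
  case (insert a A)
  let ?J = "I a" and ?s = "real (card S)"
  let ?Q = "\<lambda>x. \<exists>i\<in>I a. x i \<noteq> w a i"
  let ?R = "\<lambda>x. \<forall>a\<in>A. \<exists>i\<in>I a. x i \<noteq> w a i"
  have s1: "?s \<ge> 1" using assms(2,3) by (simp add: Suc_leI card_gt_0_iff)
  have J: "?J \<subseteq> D" "card ?J \<le> m" "w a \<in> ?J \<rightarrow> S" using insert.prems by auto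
  have finJ: "finite ?J" using J insert.prems(1) finite_subset by blast
  have dis: "I b \<inter> ?J = {}" if "b \<in> A" for b
    using disjoint_family_onD[OF insert.prems(3), of b a] insert.hyps(2) that by auto
  have "card {x \<in> D \<rightarrow>\<^sub>E S. ?Q x \<and> ?R x} \<le> card {x \<in> ?J \<rightarrow>\<^sub>E S. ?Q x} * card {x \<in> (D - ?J) \<rightarrow>\<^sub>E S. ?R x}"
  proof (rule card_PiE_split_le)
    fix x assume "?R x"
    have sub: "I b \<subseteq> D" if "b \<in> A" for b using insert.prems(2) that by auto
    show "?R (restrict x (D - ?J))"
    proof
      fix b assume b: "b \<in> A"
      with \<open>?R x\<close> obtain i where "i \<in> I b" "x i \<noteq> w b i" by blast
      with dis[OF b] sub[OF b] show "\<exists>i\<in>I b. restrict x (D - ?J) i \<noteq> w b i"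
        by (intro bexI[of _ i]) auto
    qed
  qed (use insert.prems(1) assms(2) J in auto)
  moreover have "real (card {x \<in> ?J \<rightarrow>\<^sub>E S. ?Q x}) \<le> (1 - 1 / ?s ^ m) * ?s ^ card ?J"
  proof -
    have mem: "restrict (w a) ?J \<in> ?J \<rightarrow>\<^sub>E S" using J(3) by auto
    have "{x \<in> ?J \<rightarrow>\<^sub>E S. ?Q x} \<subseteq> (?J \<rightarrow>\<^sub>E S) - {restrict (w a) ?J}" by auto
    then have "card {x \<in> ?J \<rightarrow>\<^sub>E S. ?Q x} \<le> card ((?J \<rightarrow>\<^sub>E S) - {restrict (w a) ?J})"
      using finJ assms(2) by (intro card_mono finite_Diff finite_PiE) auto
    also have "\<dots> = card S ^ card ?J - 1"
      using mem finJ assms(2) by (simp add: card_Diff_singleton card_funcsetE finite_PiE)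
    moreover have "card S ^ card ?J \<ge> 1" using s1 by simp
    ultimately have "card {x \<in> ?J \<rightarrow>\<^sub>E S. ?Q x} + 1 \<le> card S ^ card ?J" by linarith
    then have "real (card {x \<in> ?J \<rightarrow>\<^sub>E S. ?Q x}) \<le> ?s ^ card ?J - 1"
      by (simp flip: of_nat_power)
    also have "\<dots> \<le> ?s ^ card ?J - ?s ^ card ?J / ?s ^ m"
      using s1 J(2) power_increasing[OF J(2), of ?s] by (simp add: divide_le_eq)
    finally show ?thesis by (simp add: algebra_simps)
  qed
  moreover have "real (card {x \<in> (D - ?J) \<rightarrow>\<^sub>E S. ?R x}) \<le> (1 - 1 / ?s ^ m) ^ card A * ?s ^ card (D - ?J)"
  proof (rule insert.IH)
    show "disjoint_family_on I A" using insert.prems(3) by (auto simp: disjoint_family_on_def)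
    show "I b \<subseteq> D - ?J \<and> card (I b) \<le> m \<and> w b \<in> I b \<rightarrow> S" if "b \<in> A" for b
      using insert.prems(2)[of b] dis[OF that] that by blast
  qed (use insert.prems(1) in simp)
  ultimately have "real (card {x \<in> D \<rightarrow>\<^sub>E S. ?Q x \<and> ?R x}) \<le>
      ((1 - 1 / ?s ^ m) * ?s ^ card ?J) * ((1 - 1 / ?s ^ m) ^ card A * ?s ^ card (D - ?J))"
    by (smt (verit) mult_mono of_nat_0_le_iff of_nat_mono of_nat_mult)
  also have "\<dots> = (1 - 1 / ?s ^ m) ^ card (insert a A) * (?s ^ (card ?J + card (D - ?J)))"
    using insert.hyps by (simp add: power_add)
  also have "card ?J + card (D - ?J) = card D"
    using J(1) finJ insert.prems(1) by (simp add: card_Diff_subset card_mono)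
  finally show ?case by simp
qed

lemma exists_power_le:
  assumes "0 \<le> (\<theta>::real)" "\<theta> < 1" "\<delta> > 0" "c > 0"
  obtains N :: nat where "c * \<theta> ^ N \<le> \<delta>"
proof -
  obtain N where "\<theta> ^ N < \<delta> / c"
    using real_arch_pow_inv[of "\<delta> / c" \<theta>] assms by auto
  with assms(4) that[of N] show ?thesis by (simp add: field_simps)
qed

section \<open>Additive characters and almost orthogonality\<close>

text \<open>
  Expand the square. The diagonal terms are at most \<open>|X|\<close> each, and the others are correlations.
\<close>

lemma sum_norm_square_almost_orthogonal:
  fixes g :: "'q \<Rightarrow> 'x \<Rightarrow> complex"
  assumes "finite P" "\<And>q x. q \<in> P \<Longrightarrow> x \<in> X \<Longrightarrow> norm (g q x) \<le> 1"
    and orth: "\<And>q r. q \<in> P \<Longrightarrow> r \<in> P \<Longrightarrow> q \<noteq> r \<Longrightarrow> norm (\<Sum>x\<in>X. g q x * cnj (g r x)) \<le> \<delta> * real (card X)"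
    and "\<delta> \<ge> 0"
  shows "(\<Sum>x\<in>X. (norm (\<Sum>q\<in>P. g q x))\<^sup>2) \<le> (real (card P) + (real (card P))\<^sup>2 * \<delta>) * real (card X)"
proof -
  have "complex_of_real (\<Sum>x\<in>X. (norm (\<Sum>q\<in>P. g q x))\<^sup>2)
      = (\<Sum>x\<in>X. (\<Sum>q\<in>P. g q x) * cnj (\<Sum>q\<in>P. g q x))"
    by (simp add: complex_norm_square del: of_real_power)
  also have "\<dots> = (\<Sum>x\<in>X. \<Sum>q\<in>P. \<Sum>r\<in>P. g q x * cnj (g r x))"
    by (simp add: sum_product)
  also have "\<dots> = (\<Sum>q\<in>P. \<Sum>r\<in>P. \<Sum>x\<in>X. g q x * cnj (g r x))"
    by (subst sum.swap, rule sum.cong[OF refl], rule sum.swap)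
  finally have eq: "complex_of_real (\<Sum>x\<in>X. (norm (\<Sum>q\<in>P. g q x))\<^sup>2) = \<dots>" .
  have "(\<Sum>x\<in>X. (norm (\<Sum>q\<in>P. g q x))\<^sup>2) = norm (complex_of_real (\<Sum>x\<in>X. (norm (\<Sum>q\<in>P. g q x))\<^sup>2))"
    by (simp only: norm_of_real) (simp add: sum_nonneg)
  also have "\<dots> \<le> (\<Sum>q\<in>P. \<Sum>r\<in>P. norm (\<Sum>x\<in>X. g q x * cnj (g r x)))"
    unfolding eq by (intro order_trans[OF norm_sum] sum_mono norm_sum)
  also have "\<dots> \<le> (\<Sum>q\<in>P. \<Sum>r\<in>P. (if q = r then real (card X) else 0) + \<delta> * real (card X))"
  proof (intro sum_mono)
    fix q r assume qr: "q \<in> P" "r \<in> P"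
    have "norm (\<Sum>x\<in>X. g q x * cnj (g q x)) \<le> (\<Sum>x\<in>X. 1)"
      using assms(2)[OF qr(1)] by (intro sum_norm_le) (simp add: norm_mult mult_le_one)
    then show "norm (\<Sum>x\<in>X. g q x * cnj (g r x)) \<le> (if q = r then real (card X) else 0) + \<delta> * real (card X)"
      using orth[OF qr] assms(4) by (cases "q = r") (auto simp: add_increasing2)
  qed
  also have "\<dots> = (real (card P) + (real (card P))\<^sup>2 * \<delta>) * real (card X)"
    using assms(1) by (simp add: sum.distrib power2_eq_square algebra_simps)
  finally show ?thesis .
qed

definition add_char :: "nat \<Rightarrow> int \<Rightarrow> complex" where
  "add_char p t = cis (2 * pi * real_of_int t / real p)"

lemma norm_add_char [simp]: "norm (add_char p t) = 1"
  by (simp add: add_char_def)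

lemma add_char_add: "add_char p (s + t) = add_char p s * add_char p t"
  by (simp add: add_char_def cis_mult distrib_left add_divide_distrib)

lemma add_char_0 [simp]: "add_char p 0 = 1"
  by (simp add: add_char_def)

lemma add_char_sum: "add_char p (\<Sum>i\<in>I. f i) = (\<Prod>i\<in>I. add_char p (f i))"
  by (induction I rule: infinite_finite_induct) (auto simp: add_char_add)

lemma cnj_add_char: "cnj (add_char p t) = add_char p (- t)"
  by (simp add: add_char_def cis_cnj)

lemma add_char_power: "add_char p (int k * t) = add_char p t ^ k"
  by (induction k) (auto simp: add_char_add algebra_simps)

lemma add_char_eq_1_iff:
  assumes "p > 0"
  shows "add_char p t = 1 \<longleftrightarrow> int p dvd t"
proof -
  have "add_char p t = 1 \<longleftrightarrow> (\<exists>k. real_of_int t = real_of_int (int p * k))"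
    using assms by (auto simp: add_char_def cis_eq_1_iff field_simps)
  then show ?thesis unfolding of_int_eq_iff dvd_def .
qed

text \<open>
  All \<open>p\<close> multiples, including \<open>u = 0\<close>, give a complete geometric sum, which vanishes.
\<close>

lemma sum_nontrivial_add_char:
  assumes "p > 0" "\<not> int p dvd t"
  shows "(\<Sum>u\<in>{1..<p}. add_char p (int u * t)) = -1"
proof -
  have "add_char p t \<noteq> 1" "add_char p t ^ p = 1"
    using assms by (simp_all add: add_char_eq_1_iff flip: add_char_power)
  then have "(\<Sum>u<p. add_char p t ^ u) = 0"
    by (simp add: geometric_sum)
  moreover have "{..<p} = insert 0 {1..<p}" using assms(1) by auto
  ultimately have "1 + (\<Sum>u\<in>{1..<p}. add_char p (int u * t)) = 0"
    by (simp add: add_char_power)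
  then show ?thesis by (simp add: add_eq_0_iff)
qed

text \<open>
  The values of the character at \<open>a * s\<close> and \<open>a * s'\<close> are distinct points of the unit circle, so their
  sum has norm less than \<open>2\<close> by the parallelogram law. The other terms have norm \<open>1\<close>.
\<close>

lemma norm_sum_add_char_less:
  assumes "p > 0" "finite S" "s \<in> S" "s' \<in> S" "\<not> int p dvd a * (s - s')"
  shows "norm (\<Sum>s\<in>S. add_char p (a * s)) < real (card S)"
proof -
  let ?z = "add_char p (a * s)" and ?w = "add_char p (a * s')"
  have ne: "s \<noteq> s'" using assms(5) by auto
  have "?z \<noteq> ?w"
  proof
    assume "?z = ?w"
    then have "add_char p (a * s - a * s') = ?w * cnj ?w"
      using add_char_add[of p "a * s" "- (a * s')"] by (simp add: cnj_add_char)
    also have "\<dots> = 1" using complex_norm_square[of ?w] by simp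
    finally show False using assms(1,5) by (simp add: add_char_eq_1_iff right_diff_distrib)
  qed
  then have "(norm (?z - ?w))\<^sup>2 > 0" by simp
  moreover have "(norm (?z + ?w))\<^sup>2 + (norm (?z - ?w))\<^sup>2 = 2 * (norm ?z)\<^sup>2 + 2 * (norm ?w)\<^sup>2"
    unfolding cmod_power2 by (simp add: power2_eq_square algebra_simps)
  ultimately have "(norm (?z + ?w))\<^sup>2 < 4"
    unfolding norm_add_char power_one by linarith
  then have lt: "norm (?z + ?w) < 2"
    by (intro power_less_imp_less_base[of "norm (?z + ?w)" 2 2]) auto
  have S: "S = insert s (insert s' (S - {s, s'}))" using assms by auto
  have "(\<Sum>s\<in>S. add_char p (a * s)) = (?z + ?w) + (\<Sum>s\<in>S - {s, s'}. add_char p (a * s))"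
    using assms(2) ne by (subst S) (simp add: add.assoc)
  then have "norm (\<Sum>s\<in>S. add_char p (a * s)) \<le> norm (?z + ?w) + norm (\<Sum>s\<in>S - {s, s'}. add_char p (a * s))"
    by (simp add: norm_triangle_ineq)
  also have "norm (\<Sum>s\<in>S - {s, s'}. add_char p (a * s)) \<le> real (card (S - {s, s'}))"
    by (rule order_trans[OF norm_sum]) simp
  also have "norm (?z + ?w) + real (card (S - {s, s'})) < 2 + real (card (S - {s, s'}))"
    using lt by simp
  also have "\<dots> = real (card S)"
    using assms(2) ne by (subst (2) S) simp
  finally show ?thesis by simp
qed

text \<open>
  A uniform constant exists because the character sums depend on \<open>a\<close> only modulo \<open>p\<close>, which leaves
  finitely many of them.
\<close>

lemma exists_add_char_bias_bound:
  assumes "prime p" "S \<subseteq> {0..<int p}" "card S \<ge> 2"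
  obtains \<theta> where "0 \<le> \<theta>" "\<theta> < 1"
    "\<And>a. \<not> int p dvd a \<Longrightarrow> norm (\<Sum>s\<in>S. add_char p (a * s)) \<le> \<theta> * real (card S)"
proof -
  have p0: "p > 0" using assms(1) prime_gt_0_nat by blast
  have finS: "finite S" using assms(2) finite_subset by blast
  obtain s s' where s: "s \<in> S" "s' \<in> S" "s \<noteq> s'"
  proof -
    have "\<not> card S \<le> Suc 0" using assms(3) by simp
    then show ?thesis using that card_le_Suc0_iff_eq[OF finS] by blast
  qed
  let ?f = "\<lambda>a. norm (\<Sum>s\<in>S. add_char p (a * s)) / real (card S)"
  have cS: "real (card S) > 0" using assms(3) by simp
  have lt: "?f a < 1" if "\<not> int p dvd a" for a
  proof -
    have "\<bar>s - s'\<bar> < int p" using subsetD[OF assms(2) s(1)] subsetD[OF assms(2) s(2)] by auto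
    then have "\<not> int p dvd \<bar>s - s'\<bar>" using s(3) by (intro zdvd_not_zless) auto
    then have "\<not> int p dvd s - s'" by simp
    then have "\<not> int p dvd a * (s - s')" using that assms(1) by (simp add: prime_dvd_mult_iff)
    from norm_sum_add_char_less[OF p0 finS s(1,2) this] cS show ?thesis by simp
  qed
  have per: "?f a = ?f (a mod int p)" for a
  proof -
    have "add_char p (a * s) = add_char p ((a mod int p) * s)" for s
    proof -
      have "a * s = (a mod int p) * s + int p * (a div int p * s)"
        using mult_div_mod_eq[of "int p" a] by (metis distrib_right mult.assoc add.commute)
      moreover have "add_char p (int p * (a div int p * s)) = 1" using p0 by (subst add_char_eq_1_iff) auto
      ultimately show ?thesis by (simp add: add_char_add)
    qed
    then show ?thesis by simp
  qed
  let ?\<theta> = "Max (insert 0 (?f ` {1..<int p}))"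
  show ?thesis
  proof (rule that)
    show "0 \<le> ?\<theta>" by simp
    have "\<not> int p dvd a" if "a \<in> {1..<int p}" for a using that zdvd_not_zless by auto
    then show "?\<theta> < 1" using lt by simp
    fix a assume "\<not> int p dvd a"
    then have "a mod int p \<in> {1..<int p}"
      using p0 pos_mod_bound[of "int p" a] pos_mod_sign[of "int p" a] by (auto simp: dvd_eq_mod_eq_0 simp del: pos_mod_bound pos_mod_sign)
    then have "?f (a mod int p) \<le> ?\<theta>" by (intro Max_ge) auto
    then show "norm (\<Sum>s\<in>S. add_char p (a * s)) \<le> ?\<theta> * real (card S)"
      using cS per[of a] by (simp add: divide_le_eq)
  qed
qed

text \<open>
  The sum over the product set factors over the coordinates, and each coordinate with a nonzero
  coefficient gains a factor \<open>\<theta>\<close>.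
\<close>

lemma norm_sum_add_char_linear_le:
  assumes "finite S" "0 \<le> \<theta>" "\<theta> \<le> 1"
    and bias: "\<And>a. \<not> int p dvd a \<Longrightarrow> norm (\<Sum>s\<in>S. add_char p (a * s)) \<le> \<theta> * real (card S)"
    and supp: "M \<le> card {i\<in>{..<n}. \<not> int p dvd a i}"
  shows "norm (\<Sum>x\<in>{..<n} \<rightarrow>\<^sub>E S. add_char p (\<Sum>i<n. a i * x i)) \<le> \<theta> ^ M * real (card S) ^ n"
proof -
  have "(\<Sum>x\<in>{..<n} \<rightarrow>\<^sub>E S. add_char p (\<Sum>i<n. a i * x i)) = (\<Prod>i<n. \<Sum>s\<in>S. add_char p (a i * s))"
    using assms(1) by (subst prod_sum_PiE) (auto simp: add_char_sum)
  also have "norm \<dots> \<le> (\<Prod>i<n. (if \<not> int p dvd a i then \<theta> else 1) * real (card S))"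
    unfolding prod_norm[symmetric]
  proof (rule prod_mono, intro conjI)
    fix i
    have "norm (\<Sum>s\<in>S. add_char p (a i * s)) \<le> real (card S)"
      by (rule order_trans[OF norm_sum]) simp
    then show "norm (\<Sum>s\<in>S. add_char p (a i * s)) \<le> (if \<not> int p dvd a i then \<theta> else 1) * real (card S)"
      using bias[of "a i"] by simp
  qed auto
  also have "\<dots> = \<theta> ^ card {i\<in>{..<n}. \<not> int p dvd a i} * real (card S) ^ n"
    by (simp add: prod.distrib prod.If_cases Int_def)
  also have "\<dots> \<le> \<theta> ^ M * real (card S) ^ n"
    using assms supp by (intro mult_right_mono power_decreasing) auto
  finally show ?thesis .
qed

section \<open>Conditions given by coefficient vectors\<close>

definition dot :: "nat \<Rightarrow> (nat \<Rightarrow> int) \<Rightarrow> (nat \<Rightarrow> int) \<Rightarrow> int" where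
  "dot n a x = (\<Sum>i<n. a i * x i)"

locale prime_alphabet =
  fixes p :: nat and S :: "int set"
  assumes prime_p: "prime p" and S_subset: "S \<subseteq> {0..<int p}" and S_nonempty: "S \<noteq> {}"
begin

definition coeffs :: "nat \<Rightarrow> (nat \<Rightarrow> int) set" where
  "coeffs n = {..<n} \<rightarrow>\<^sub>E {0..<int p}"

definition conds :: "nat \<Rightarrow> ((nat \<Rightarrow> int) \<times> int set) set" where
  "conds n = coeffs n \<times> Pow {0..<int p}"

definition sat :: "nat \<Rightarrow> ((nat \<Rightarrow> int) \<times> int set) set \<Rightarrow> (nat \<Rightarrow> int) set" where
  "sat n F = {x \<in> {..<n} \<rightarrow>\<^sub>E S. \<forall>(a, E)\<in>F. dot n a x mod int p \<in> E}"

text \<open>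
  The coefficient-vector counterpart of the theorem's conclusion for a single family, with the bound
  \<open>K\<close> on the number of conditions.
\<close>

definition approximable :: "nat \<Rightarrow> nat \<Rightarrow> real \<Rightarrow> ((nat \<Rightarrow> int) \<times> int set) set \<Rightarrow> bool" where
  "approximable n K \<epsilon> F \<longleftrightarrow> (\<exists>G\<subseteq>conds n. finite G \<and> card G \<le> K \<and> sat n G \<subseteq> sat n F \<and>
     real (card (sat n F - sat n G)) \<le> \<epsilon> * real (card S) ^ n)"

lemma coeffs_mem: "a \<in> coeffs n \<Longrightarrow> i < n \<Longrightarrow> a i \<in> {0..<int p}"
  using PiE_mem[of a "{..<n}" "\<lambda>_. {0..<int p}" i] by (simp add: coeffs_def)

lemma p_pos [simp]: "p > 0" and p_gt_1: "p > 1"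
  using prime_gt_0_nat[OF prime_p] prime_gt_1_nat[OF prime_p] by simp_all

lemma finite_S [simp]: "finite S"
  using finite_subset[OF S_subset] by simp

lemma card_S_ge_1: "real (card S) \<ge> 1"
  using S_nonempty by (simp add: Suc_leI card_gt_0_iff)

lemma finite_S_power [simp]: "finite ({..<n::nat} \<rightarrow>\<^sub>E S)"
  by (intro finite_PiE) auto

lemma finite_sat [simp]: "finite (sat n F)"
  by (simp add: sat_def)

lemma approximable_mono:
  "approximable n K \<epsilon> F \<Longrightarrow> K \<le> K' \<Longrightarrow> approximable n K' \<epsilon> F"
  unfolding approximable_def by (elim exE conjE, rule_tac x = G in exI) auto

text \<open>
  The zero form with the empty set of values is a condition that no point satisfies.
\<close>

lemma approximable_if_sat_small:
  assumes "real (card (sat n F)) \<le> \<epsilon> * real (card S) ^ n"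
  shows "approximable n 1 \<epsilon> F"
proof -
  let ?G = "{(restrict (\<lambda>_. 0) {..<n}, {})} :: ((nat \<Rightarrow> int) \<times> int set) set"
  have "sat n ?G = {}" by (simp add: sat_def)
  moreover have "?G \<subseteq> conds n" by (auto simp: conds_def coeffs_def)
  ultimately show ?thesis
    unfolding approximable_def using assms by (intro exI[of _ ?G]) simp
qed

text \<open>
  The union of approximations of the classes is an approximation: satisfying sets of unions are
  intersections, so a point is lost only if it is lost in some class, and the errors add up.
\<close>

lemma approximable_partition:
  assumes "finite C" "card C \<le> k" "k > 0" "\<kappa> ` F \<subseteq> C" "\<epsilon> \<ge> 0"
    and cl: "\<And>c. c \<in> C \<Longrightarrow> approximable n K (\<epsilon> / real k) {f \<in> F. \<kappa> f = c}"
  shows "approximable n (k * K) \<epsilon> F"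
proof -
  let ?F = "\<lambda>c. {f \<in> F. \<kappa> f = c}" and ?s = "real (card S) ^ n"
  define G where "G c = (SOME G. G \<subseteq> conds n \<and> finite G \<and> card G \<le> K \<and> sat n G \<subseteq> sat n (?F c) \<and>
     real (card (sat n (?F c) - sat n G)) \<le> \<epsilon> / real k * ?s)" for c
  have G: "G c \<subseteq> conds n \<and> finite (G c) \<and> card (G c) \<le> K \<and>
      sat n (G c) \<subseteq> sat n (?F c) \<and> real (card (sat n (?F c) - sat n (G c))) \<le> \<epsilon> / real k * ?s"
    if "c \<in> C" for c
    using someI_ex[OF cl[OF that, unfolded approximable_def]] unfolding G_def .
  have card_le: "real (card C) \<le> real k" using assms(2) by simp
  have "card (\<Union>c\<in>C. G c) \<le> (\<Sum>c\<in>C. K)"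
    using G assms(1) by (intro order_trans[OF card_UN_le] sum_mono) auto
  also have "\<dots> \<le> k * K" using assms(2) by simp
  finally have 1: "card (\<Union>c\<in>C. G c) \<le> k * K" .
  have 2: "sat n (\<Union>c\<in>C. G c) \<subseteq> sat n F"
  proof
    fix x assume x: "x \<in> sat n (\<Union>c\<in>C. G c)"
    have "dot n a x mod int p \<in> E" if f: "(a, E) \<in> F" for a E
    proof -
      have c: "\<kappa> (a, E) \<in> C" using f assms(4) by blast
      then have "x \<in> sat n (G (\<kappa> (a, E)))" using x by (auto simp: sat_def)
      then have "x \<in> sat n (?F (\<kappa> (a, E)))" using G[OF c] by blast
      with f show ?thesis by (auto simp: sat_def)
    qed
    with x show "x \<in> sat n F" by (auto simp: sat_def)
  qed
  have "sat n F - sat n (\<Union>c\<in>C. G c) \<subseteq> (\<Union>c\<in>C. sat n (?F c) - sat n (G c))"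
    by (auto simp: sat_def)
  then have "card (sat n F - sat n (\<Union>c\<in>C. G c)) \<le> card (\<Union>c\<in>C. sat n (?F c) - sat n (G c))"
    using assms(1) by (intro card_mono) auto
  also have "\<dots> \<le> (\<Sum>c\<in>C. card (sat n (?F c) - sat n (G c)))"
    by (rule card_UN_le[OF assms(1)])
  finally have "real (card (sat n F - sat n (\<Union>c\<in>C. G c))) \<le> (\<Sum>c\<in>C. real (card (sat n (?F c) - sat n (G c))))"
    by (simp only: of_nat_sum[symmetric] of_nat_le_iff)
  also have "\<dots> \<le> (\<Sum>c\<in>C. \<epsilon> / real k * ?s)"
    using G by (intro sum_mono) blast
  also have "\<dots> = real (card C) / real k * (\<epsilon> * ?s)" by simp
  also have "\<dots> \<le> 1 * (\<epsilon> * ?s)"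
    using card_le assms(3,5) by (intro mult_right_mono) auto
  finally have 3: "real (card (sat n F - sat n (\<Union>c\<in>C. G c))) \<le> \<epsilon> * ?s" by simp
  show ?thesis
    unfolding approximable_def using 1 2 3 G assms(1)
    by (intro exI[of _ "\<Union>c\<in>C. G c"]) auto
qed

section \<open>Conditions close to a fixed form\<close>

definition differing :: "nat \<Rightarrow> (nat \<Rightarrow> int) \<Rightarrow> (nat \<Rightarrow> int) \<Rightarrow> nat set" where
  "differing n a b = {i \<in> {..<n}. a i \<noteq> b i}"

lemma finite_differing [simp]: "finite (differing n a b)"
  by (simp add: differing_def)

lemma dot_diff_cong:
  assumes "\<And>i. i \<in> differing n a b \<Longrightarrow> x i = y i"
  shows "dot n a x - dot n b x = dot n a y - dot n b y"
proof -
  have "dot n a x - dot n b x = (\<Sum>i<n. (a i - b i) * x i)"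
    by (simp add: dot_def sum_subtractf left_diff_distrib)
  also have "\<dots> = (\<Sum>i<n. (a i - b i) * y i)"
    using assms by (intro sum.cong) (auto simp: differing_def)
  also have "\<dots> = dot n a y - dot n b y"
    by (simp add: dot_def sum_subtractf left_diff_distrib)
  finally show ?thesis .
qed

definition diff_range :: "nat \<Rightarrow> (nat \<Rightarrow> int) \<Rightarrow> (nat \<Rightarrow> int) \<Rightarrow> int set" where
  "diff_range n b a = (\<lambda>x. (dot n a x - dot n b x) mod int p) ` ({..<n} \<rightarrow>\<^sub>E S)"

lemma diff_range_subset: "diff_range n b a \<subseteq> {0..<int p}"
  unfolding diff_range_def by (intro image_subsetI) simp

text \<open>
  A lost point \<open>x\<close> has \<open>b(x) + t \<notin> E\<close> for some \<open>t \<in> T\<close>. For each \<open>a \<in> A\<close> fix a point at which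
  \<open>a - b\<close> takes the value \<open>t\<close>. Since \<open>a(x) \<in> E\<close>, the point \<open>x\<close> cannot agree with it on the support of
  \<open>a - b\<close>. These are independent restrictions on \<open>x\<close>, for at most \<open>p\<close> values of \<open>t\<close>.
\<close>

lemma card_sat_disjoint_diff_le:
  assumes A: "finite A" "disjoint_family_on (\<lambda>a. differing n a b) A" "A \<times> {E} \<subseteq> F"
    and small: "\<And>a. a \<in> A \<Longrightarrow> card (differing n a b) \<le> m"
    and T: "\<And>a. a \<in> A \<Longrightarrow> diff_range n b a = T" "T \<subseteq> {0..<int p}"
  shows "real (card (sat n F - sat n {(b, {c \<in> {0..<int p}. \<forall>t\<in>T. (c + t) mod int p \<in> E})}))
     \<le> real p * (1 - 1 / real (card S) ^ m) ^ card A * real (card S) ^ n"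
proof -
  let ?V = "sat n F - sat n {(b, {c \<in> {0..<int p}. \<forall>t\<in>T. (c + t) mod int p \<in> E})}"
  have "\<forall>t\<in>T. \<forall>a\<in>A. \<exists>x\<in>{..<n} \<rightarrow>\<^sub>E S. (dot n a x - dot n b x) mod int p = t"
    using T(1) unfolding diff_range_def by force
  then obtain w where w: "\<And>t a. t \<in> T \<Longrightarrow> a \<in> A \<Longrightarrow> w t a \<in> {..<n} \<rightarrow>\<^sub>E S"
      "\<And>t a. t \<in> T \<Longrightarrow> a \<in> A \<Longrightarrow> (dot n a (w t a) - dot n b (w t a)) mod int p = t"
    by metis
  let ?W = "\<lambda>t. {x \<in> {..<n} \<rightarrow>\<^sub>E S. \<forall>a\<in>A. \<exists>i\<in>differing n a b. x i \<noteq> w t a i}"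
  have finT: "finite T" "card T \<le> p"
    using T(2) finite_subset card_mono[of "{0..<int p}" T] by auto
  have "?V \<subseteq> (\<Union>t\<in>T. ?W t)"
  proof
    fix x assume x: "x \<in> ?V"
    then have xS: "x \<in> {..<n} \<rightarrow>\<^sub>E S" by (auto simp: sat_def)
    with x obtain t where t: "t \<in> T" "(dot n b x mod int p + t) mod int p \<notin> E"
      by (auto simp: sat_def)
    have "\<exists>i\<in>differing n a b. x i \<noteq> w t a i" if a: "a \<in> A" for a
    proof (rule ccontr)
      assume "\<not> ?thesis"
      then have "dot n a x - dot n b x = dot n a (w t a) - dot n b (w t a)"
        by (intro dot_diff_cong) auto
      then have "(dot n b x mod int p + t) mod int p = dot n a x mod int p"
        using w(2)[OF t(1) a] by (metis diff_add_cancel add.commute mod_add_eq)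
      moreover have "dot n a x mod int p \<in> E"
        using x a A(3) by (auto simp: sat_def)
      ultimately show False using t(2) by simp
    qed
    with xS t(1) show "x \<in> (\<Union>t\<in>T. ?W t)" by blast
  qed
  then have "card ?V \<le> card (\<Union>t\<in>T. ?W t)"
    using finT by (intro card_mono) auto
  also have "\<dots> \<le> (\<Sum>t\<in>T. card (?W t))" by (rule card_UN_le[OF finT(1)])
  finally have "real (card ?V) \<le> (\<Sum>t\<in>T. real (card (?W t)))"
    by (simp only: of_nat_sum[symmetric] of_nat_le_iff)
  also have "\<dots> \<le> (\<Sum>t\<in>T. (1 - 1 / real (card S) ^ m) ^ card A * real (card S) ^ card {..<n})"
  proof (intro sum_mono card_avoid_patterns_le)
    fix t a assume "t \<in> T" "a \<in> A"
    then show "differing n a b \<subseteq> {..<n} \<and> card (differing n a b) \<le> m \<and> w t a \<in> differing n a b \<rightarrow> S"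
      using small[of a] w(1)[of t a] by (auto simp: differing_def)
  qed (use A S_nonempty in auto)
  also have "\<dots> = real (card T) * ((1 - 1 / real (card S) ^ m) ^ card A * real (card S) ^ n)"
    by simp
  also have "\<dots> \<le> real p * ((1 - 1 / real (card S) ^ m) ^ card A * real (card S) ^ n)"
    using finT(2) card_S_ge_1 by (intro mult_right_mono mult_nonneg_nonneg zero_le_power) (auto simp: divide_le_eq)
  finally show ?thesis by (simp add: mult.assoc)
qed

text \<open>
  Induction on the number \<open>m\<close> of coefficients in which the forms differ from \<open>b\<close>. In the step the
  conditions are first sorted by the range of \<open>a - b\<close> on \<open>S ^ n\<close>. Within a class, either there are \<open>N\<close>
  disjoint supports and the projected condition on \<open>b\<close> works, or a set \<open>J\<close> of at most \<open>N (m + 1)\<close>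
  coordinates meets all nonempty supports, and replacing the coefficients of \<open>b\<close> on \<open>J\<close> by those of \<open>a\<close>
  yields one of at most \<open>p ^ (N (m + 1))\<close> forms that are closer to \<open>a\<close>.
\<close>

lemma approximable_nearby_conditions:
  assumes "\<epsilon> > 0"
  shows "\<exists>K. \<forall>n b E F. b \<in> coeffs n \<longrightarrow> E \<subseteq> {0..<int p} \<longrightarrow> F \<subseteq> coeffs n \<longrightarrow>
    (\<forall>a\<in>F. card (differing n a b) \<le> m) \<longrightarrow> approximable n K \<epsilon> (F \<times> {E})"
  using assms
proof (induction m arbitrary: \<epsilon>)
  case 0
  show ?case
  proof (intro exI[of _ 1] allI impI)
    fix n b E F
    assume b: "b \<in> coeffs n" and E: "E \<subseteq> {0..<int p}" and F: "F \<subseteq> coeffs n" and d: "\<forall>a\<in>F. card (differing n a b) \<le> 0"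
    have "a = b" if "a \<in> F" for a
    proof (rule PiE_ext)
      show "a \<in> {..<n} \<rightarrow>\<^sub>E {0..<int p}" "b \<in> {..<n} \<rightarrow>\<^sub>E {0..<int p}"
        using that b F by (auto simp: coeffs_def)
      show "a i = b i" if i: "i \<in> {..<n}" for i
        using d i \<open>a \<in> F\<close> by (auto simp: differing_def)
    qed
    then have "F \<times> {E} \<subseteq> {(b, E)}" by auto
    then show "approximable n 1 \<epsilon> (F \<times> {E})"
      unfolding approximable_def using b E 0 card_mono[of "{(b, E)}" "F \<times> {E}"] finite_subset[of "F \<times> {E}" "{(b, E)}"]
      by (intro exI[of _ "F \<times> {E}"]) (auto simp: conds_def)
  qed
next
  case (Suc m)
  define \<theta> where "\<theta> = 1 - 1 / real (card S) ^ Suc m"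
  have \<theta>: "0 \<le> \<theta>" "\<theta> < 1"
    using card_S_ge_1 one_le_power[OF card_S_ge_1, of "Suc m"] by (auto simp: \<theta>_def divide_le_eq)
  \<comment> \<open>There are at most \<open>2 ^ p\<close> possible ranges of \<open>a - b\<close>, and the error is shared equally among them.\<close>
  define \<epsilon>\<^sub>1 where "\<epsilon>\<^sub>1 = \<epsilon> / real (2 ^ p)"
  have \<epsilon>\<^sub>1: "\<epsilon>\<^sub>1 > 0" using Suc.prems by (simp add: \<epsilon>\<^sub>1_def)
  obtain N where N: "real p * \<theta> ^ N \<le> \<epsilon>\<^sub>1"
    using exists_power_le[OF \<theta> \<epsilon>\<^sub>1, of "real p"] by auto
  \<comment> \<open>A bound for the number of coefficient patterns on the coordinates \<open>J\<close> below.\<close>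
  define k where "k = p ^ (N * Suc m)"
  have k: "k > 0" by (simp add: k_def)
  have "\<epsilon>\<^sub>1 / real k > 0" using \<epsilon>\<^sub>1 k by simp
  from Suc.IH[OF this] obtain K where K: "\<forall>n b E F. b \<in> coeffs n \<longrightarrow> E \<subseteq> {0..<int p} \<longrightarrow> F \<subseteq> coeffs n \<longrightarrow>
      (\<forall>a\<in>F. card (differing n a b) \<le> m) \<longrightarrow> approximable n K (\<epsilon>\<^sub>1 / real k) (F \<times> {E})" ..
  show ?case
  proof (intro exI[of _ "2 ^ p * (1 + k * K)"] allI impI)
    fix n b E F
    assume b: "b \<in> coeffs n" and E: "E \<subseteq> {0..<int p}" and F: "F \<subseteq> coeffs n" and d: "\<forall>a\<in>F. card (differing n a b) \<le> Suc m"
    show "approximable n (2 ^ p * (1 + k * K)) \<epsilon> (F \<times> {E})"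
    proof (rule approximable_partition[of "Pow {0..<int p}" "2 ^ p" "\<lambda>(a, E). diff_range n b a"])
      fix T assume T: "T \<in> Pow {0..<int p}"
      define F' where "F' = {a \<in> F. diff_range n b a = T}"
      have F': "F' \<subseteq> coeffs n" and d': "\<And>a. a \<in> F' \<Longrightarrow> card (differing n a b) \<le> Suc m"
        using F d by (auto simp: F'_def)
      have sym: "symp (\<lambda>a a'. differing n a b \<inter> differing n a' b = {})"
        by (auto simp: symp_def)
      have "approximable n (1 + k * K) \<epsilon>\<^sub>1 (F' \<times> {E})"
        using pairwise_subset_or_maximal[OF sym, of F' N]
      proof (elim disjE exE conjE)
        fix A assume A: "A \<subseteq> F'" "finite A" "card A = N" "pairwise (\<lambda>a a'. differing n a b \<inter> differing n a' b = {}) A"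
        let ?G = "{(b, {c \<in> {0..<int p}. \<forall>t\<in>T. (c + t) mod int p \<in> E})}"
        have "real (card (sat n (F' \<times> {E}) - sat n ?G)) \<le> real p * (1 - 1 / real (card S) ^ Suc m) ^ card A * real (card S) ^ n"
        proof (rule card_sat_disjoint_diff_le)
          show "disjoint_family_on (\<lambda>a. differing n a b) A"
            using A(4) unfolding disjoint_family_on_def pairwise_def by blast
        qed (use A T d' in \<open>auto simp: F'_def\<close>)
        also have "\<dots> \<le> \<epsilon>\<^sub>1 * real (card S) ^ n"
          using N A(3) unfolding \<theta>_def by (intro mult_right_mono) auto
        finally have small: "real (card (sat n (F' \<times> {E}) - sat n ?G)) \<le> \<epsilon>\<^sub>1 * real (card S) ^ n" .
        have "sat n ?G \<subseteq> sat n (F' \<times> {E})"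
        proof
          fix x assume x: "x \<in> sat n ?G"
          then have xS: "x \<in> {..<n} \<rightarrow>\<^sub>E S" by (auto simp: sat_def)
          have "dot n a x mod int p \<in> E" if a: "a \<in> F'" for a
          proof -
            have "(dot n a x - dot n b x) mod int p \<in> T"
              using a xS by (auto simp: F'_def diff_range_def)
            then have "(dot n b x mod int p + (dot n a x - dot n b x) mod int p) mod int p \<in> E"
              using x by (auto simp: sat_def)
            then show ?thesis by (simp add: mod_add_eq)
          qed
          with xS show "x \<in> sat n (F' \<times> {E})" by (auto simp: sat_def)
        qed
        with small show ?thesis
          unfolding approximable_def using b by (intro exI[of _ ?G]) (auto simp: conds_def)
      next
        fix A assume A: "A \<subseteq> F'" "finite A" "card A < N"
          and max: "\<forall>a\<in>F'. a \<in> A \<or> (\<exists>a'\<in>A. differing n a b \<inter> differing n a' b \<noteq> {})"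
        define J where "J = (\<Union>a\<in>A. differing n a b)"
        have "card J \<le> (\<Sum>a\<in>A. Suc m)"
          unfolding J_def using A(1,2) d' by (intro order_trans[OF card_UN_le] sum_mono) auto
        also have "\<dots> \<le> N * Suc m" using A(3) by (simp only: sum_constant) (intro mult_le_mono1, simp)
        finally have cJ: "card J \<le> N * Suc m" .
        have J: "J \<subseteq> {..<n}" "finite J" using A(2) by (auto simp: J_def differing_def)
        define graft where "graft g = (\<lambda>i\<in>{..<n}. if i \<in> J then g i else b i)" for g :: "nat \<Rightarrow> int"
        define C where "C = graft ` (J \<rightarrow>\<^sub>E {0..<int p})"
        have finC: "finite C" unfolding C_def using J(2) by (intro finite_imageI finite_PiE) auto
        have "card C \<le> card (J \<rightarrow>\<^sub>E {0..<int p})"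
          unfolding C_def using J(2) by (intro card_image_le finite_PiE) auto
        also have "\<dots> = p ^ card J" using J(2) by (simp add: card_funcsetE)
        also have "\<dots> \<le> k" unfolding k_def using cJ by (intro power_increasing) (auto simp: Suc_leI)
        finally have cC: "card C \<le> k" .
        have graft_in: "graft a \<in> C" if "a \<in> F'" for a
        proof -
          have "graft a = graft (restrict a J)" by (auto simp: graft_def)
          moreover have "a \<in> {..<n} \<rightarrow>\<^sub>E {0..<int p}"
            using that F' unfolding coeffs_def by blast
          then have "restrict a J \<in> J \<rightarrow>\<^sub>E {0..<int p}"
            using J(1) by (intro restrict_PiE_iff[THEN iffD2] ballI PiE_mem[of a "{..<n}" "\<lambda>_. {0..<int p}"]) auto
          ultimately show ?thesis unfolding C_def by blast
        qed
        have "approximable n (k * K) \<epsilon>\<^sub>1 (F' \<times> {E})"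
        proof (rule approximable_partition[OF finC cC k, of "\<lambda>(a, E). graft a"])
          fix c assume c: "c \<in> C"
          have c_coeffs: "c \<in> coeffs n"
          proof -
            obtain g where g: "g \<in> J \<rightarrow>\<^sub>E {0..<int p}" "c = graft g" using c by (auto simp: C_def)
            have "(if i \<in> J then g i else b i) \<in> {0..<int p}" if "i \<in> {..<n}" for i
              using PiE_mem[OF g(1), of i] coeffs_mem[OF b, of i] that by simp
            then show ?thesis unfolding g(2) graft_def coeffs_def by (simp only: restrict_PiE_iff) blast
          qed
          have "card (differing n a c) \<le> m" if a: "a \<in> F'" "graft a = c" for a
          proof -
            \<comment> \<open>The new centre agrees with \<open>a\<close> on \<open>J\<close>, and \<open>J\<close> meets the old difference set unless that is empty.\<close>
            have "differing n a c = differing n a b - J"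
              unfolding a(2)[symmetric] by (auto simp: differing_def graft_def)
            moreover have "card (differing n a b - J) \<le> m"
            proof (cases "differing n a b = {}")
              case False
              then have "differing n a b \<inter> J \<noteq> {}" using max a(1) unfolding J_def by blast
              then have "card (differing n a b - J) < card (differing n a b)"
                by (intro psubset_card_mono) auto
              with d'[OF a(1)] show ?thesis by simp
            qed simp
            ultimately show ?thesis by simp
          qed
          then have "approximable n K (\<epsilon>\<^sub>1 / real k) ({a \<in> F'. graft a = c} \<times> {E})"
            using F' by (intro K[rule_format, OF c_coeffs E]) auto
          moreover have "{f \<in> F' \<times> {E}. (case f of (a, E) \<Rightarrow> graft a) = c} = {a \<in> F'. graft a = c} \<times> {E}"
            by auto
          ultimately show "approximable n K (\<epsilon>\<^sub>1 / real k) {f \<in> F' \<times> {E}. (case f of (a, E) \<Rightarrow> graft a) = c}"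
            by simp
        qed (use graft_in \<epsilon>\<^sub>1 in auto)
        then show ?thesis by (rule approximable_mono) simp
      qed
      moreover have "{f \<in> F \<times> {E}. (case f of (a, E) \<Rightarrow> diff_range n b a) = T} = F' \<times> {E}"
        by (auto simp: F'_def)
      ultimately show "approximable n (1 + k * K) (\<epsilon> / real (2 ^ p)) {f \<in> F \<times> {E}. (case f of (a, E) \<Rightarrow> diff_range n b a) = T}"
        by (simp only: \<epsilon>\<^sub>1_def)
    next
      show "(\<lambda>(a, E). diff_range n b a) ` (F \<times> {E}) \<subseteq> Pow {0..<int p}"
        using diff_range_subset[of n b] by auto
      show "card (Pow {0..<int p}) \<le> 2 ^ p" by (simp add: card_Pow)
      show "\<epsilon> \<ge> 0" using Suc.prems by simp
    qed simp_all
  qed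
qed

section \<open>Forms that are far apart\<close>

definition comb_support :: "nat \<Rightarrow> nat \<Rightarrow> (nat \<Rightarrow> int) \<Rightarrow> nat \<Rightarrow> (nat \<Rightarrow> int) \<Rightarrow> nat set" where
  "comb_support n u a v b = {i \<in> {..<n}. \<not> int p dvd int u * a i - int v * b i}"

text \<open>
  Using multiples of both forms makes the relation symmetric. For equal forms it fails when \<open>M > 0\<close>,
  so it is meant for distinct members of a family.
\<close>

definition far_apart :: "nat \<Rightarrow> nat \<Rightarrow> (nat \<Rightarrow> int) \<Rightarrow> (nat \<Rightarrow> int) \<Rightarrow> bool" where
  "far_apart n M a b \<longleftrightarrow> (\<forall>u\<in>{1..<p}. \<forall>v\<in>{1..<p}. M \<le> card (comb_support n u a v b))"

lemma comb_support_commute: "comb_support n u a v b = comb_support n v b u a"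
  unfolding comb_support_def by (metis (no_types) dvd_minus_iff minus_diff_eq)

lemma symp_far_apart: "symp (far_apart n M)"
  unfolding far_apart_def symp_def using comb_support_commute by metis

text \<open>
  Two characters that come from the same form are almost orthogonal as soon as that form has many
  nonzero coefficients.
\<close>

lemma comb_support_multiples:
  assumes "a \<in> coeffs n" "u \<in> {1..<p}" "v \<in> {1..<p}" "u \<noteq> v"
  shows "comb_support n u a v a = differing n a (\<lambda>_. 0)"
proof -
  have uv: "\<not> int p dvd int u - int v"
  proof -
    have "\<not> int p dvd \<bar>int u - int v\<bar>" using assms by (intro zdvd_not_zless) auto
    then show ?thesis by simp
  qed
  have "int p dvd int u * a i - int v * a i \<longleftrightarrow> a i = 0" if "i < n" for i
  proof -
    have "a i \<in> {0..<int p}" using assms(1) that by (rule coeffs_mem)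
    then have "int p dvd a i \<longleftrightarrow> a i = 0" using zdvd_not_zless[of "a i" "int p"] by fastforce
    moreover have "int u * a i - int v * a i = (int u - int v) * a i" by (simp add: algebra_simps)
    ultimately show ?thesis using uv prime_p by (simp add: prime_dvd_mult_iff)
  qed
  then show ?thesis by (auto simp: comb_support_def differing_def)
qed

text \<open>
  If \<open>u a - v b\<close> has few nonzero coefficients, then \<open>a\<close> is close to \<open>(v / u) b\<close>.
\<close>

lemma near_multiple_if_not_far_apart:
  assumes "a \<in> coeffs n" "\<not> far_apart n M a b"
  obtains c where "c \<in> {0..<int p}" "card (differing n a (\<lambda>i\<in>{..<n}. c * b i mod int p)) \<le> M"
proof -
  obtain u v where uv: "u \<in> {1..<p}" "v \<in> {1..<p}" "card (comb_support n u a v b) < M"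
    using assms(2) by (auto simp: far_apart_def not_le)
  have "\<not> p dvd u" using uv(1) by (auto dest: dvd_imp_le)
  then have "coprime (int u) (int p)"
    using prime_p by (metis coprime_commute coprime_int_iff prime_imp_coprime)
  then obtain w where w: "[int u * w = 1] (mod int p)"
    using cong_solve_coprime_int by blast
  define c where "c = w * int v mod int p"
  have "a i = c * b i mod int p" if i: "i < n" "int p dvd int u * a i - int v * b i" for i
  proof -
    have "[int u * a i = int v * b i] (mod int p)" using i(2) by (simp add: cong_iff_dvd_diff)
    then have "[w * (int u * a i) = w * (int v * b i)] (mod int p)" by (rule cong_scalar_left)
    moreover have "[w * (int u * a i) = a i] (mod int p)"
      using cong_scalar_right[OF w, of "a i"] by (simp add: ac_simps)
    ultimately have "a i mod int p = w * int v * b i mod int p"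
      by (simp add: cong_def mult.assoc)
    moreover have "a i \<in> {0..<int p}" using assms(1) i(1) by (rule coeffs_mem)
    ultimately show ?thesis by (simp add: c_def mod_mult_left_eq)
  qed
  then have "differing n a (\<lambda>i\<in>{..<n}. c * b i mod int p) \<subseteq> comb_support n u a v b"
    by (auto simp: differing_def comb_support_def)
  then have "card (differing n a (\<lambda>i\<in>{..<n}. c * b i mod int p)) \<le> card (comb_support n u a v b)"
    by (intro card_mono) (auto simp: comb_support_def)
  with uv(3) show ?thesis by (intro that[of c]) (auto simp: c_def)
qed

text \<open>
  Let \<open>f(x)\<close> be the sum of \<open>e(u (a(x) - y a) / p)\<close> over all \<open>a \<in> A\<close> and \<open>0 < u < p\<close>. It equals
  \<open>- |A|\<close> if \<open>x\<close> avoids all the values \<open>y a\<close>, whereas the mean square of \<open>f\<close> is at most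
  \<open>p |A|\<close> plus the small correlations.
\<close>

lemma card_avoid_values_le:
  assumes A: "A \<subseteq> coeffs n" "finite A" "A \<noteq> {}" "pairwise (far_apart n M) A"
    and heavy: "\<And>a. a \<in> A \<Longrightarrow> M \<le> card (differing n a (\<lambda>_. 0))"
    and \<theta>: "0 \<le> \<theta>" "\<theta> \<le> 1"
    and bias: "\<And>a. \<not> int p dvd a \<Longrightarrow> norm (\<Sum>s\<in>S. add_char p (a * s)) \<le> \<theta> * real (card S)"
  shows "real (card {x \<in> {..<n} \<rightarrow>\<^sub>E S. \<forall>a\<in>A. \<not> int p dvd dot n a x - y a})
     \<le> (real p / real (card A) + (real p)\<^sup>2 * \<theta> ^ M) * real (card S) ^ n"
proof -
  let ?X = "{..<n} \<rightarrow>\<^sub>E S" and ?P = "A \<times> {1..<p}"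
  let ?W = "{x \<in> ?X. \<forall>a\<in>A. \<not> int p dvd dot n a x - y a}"
  define g where "g q x = add_char p (int (snd q) * (dot n (fst q) x - y (fst q)))" for q :: "(nat \<Rightarrow> int) \<times> nat" and x
  have cP: "real (card ?P) \<le> real (card A * p)" unfolding of_nat_le_iff by (simp add: card_cartesian_product)
  have cA: "real (card A) > 0" using A by (simp add: card_gt_0_iff)
  have cX: "real (card ?X) = real (card S) ^ n" by (simp add: card_funcsetE)
  have orth: "norm (\<Sum>x\<in>?X. g q x * cnj (g r x)) \<le> \<theta> ^ M * real (card ?X)"
    if qr: "q \<in> ?P" "r \<in> ?P" "q \<noteq> r" for q r
  proof -
    obtain a u b v where q: "q = (a, u)" and r: "r = (b, v)" by (cases q, cases r)
    have M: "M \<le> card (comb_support n u a v b)"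
    proof (cases "a = b")
      case True
      then show ?thesis using qr q r A(1) heavy[of a] comb_support_multiples[of a n u v] by auto
    next
      case False
      then show ?thesis using qr q r A(4) by (auto simp: pairwise_def far_apart_def)
    qed
    let ?c = "add_char p (int v * y b - int u * y a)"
    have "g q x * cnj (g r x) = ?c * add_char p (\<Sum>i<n. (int u * a i - int v * b i) * x i)" for x
    proof -
      have "(\<Sum>i<n. (int u * a i - int v * b i) * x i) = int u * dot n a x - int v * dot n b x"
        by (simp add: dot_def sum_distrib_left left_diff_distrib sum_subtractf mult.assoc)
      then show ?thesis
        by (simp only: g_def q r fst_conv snd_conv cnj_add_char add_char_add[symmetric])
          (simp add: algebra_simps)
    qed
    then have "norm (\<Sum>x\<in>?X. g q x * cnj (g r x))
        = norm (\<Sum>x\<in>?X. add_char p (\<Sum>i<n. (int u * a i - int v * b i) * x i))"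
      by (simp add: sum_distrib_left[symmetric] norm_mult)
    also have "\<dots> \<le> \<theta> ^ M * real (card S) ^ n"
      using M \<theta> bias unfolding comb_support_def by (intro norm_sum_add_char_linear_le) auto
    finally show ?thesis by (simp add: cX)
  qed
  have on_W: "(\<Sum>q\<in>?P. g q x) = - of_nat (card A)" if x: "x \<in> ?W" for x
  proof -
    have "(\<Sum>q\<in>?P. g q x) = (\<Sum>a\<in>A. \<Sum>u\<in>{1..<p}. g (a, u) x)"
      by (simp add: sum.cartesian_product)
    also have "\<dots> = (\<Sum>a\<in>A. -1)"
    proof (rule sum.cong)
      fix a assume "a \<in> A"
      then show "(\<Sum>u\<in>{1..<p}. g (a, u) x) = -1"
        using x sum_nontrivial_add_char[OF p_pos, of "dot n a x - y a"] by (simp add: g_def)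
    qed simp
    finally show ?thesis by simp
  qed
  have "real (card ?W) * (real (card A))\<^sup>2 = (\<Sum>x\<in>?W. (norm (\<Sum>q\<in>?P. g q x))\<^sup>2)"
    using on_W by simp
  also have "\<dots> \<le> (\<Sum>x\<in>?X. (norm (\<Sum>q\<in>?P. g q x))\<^sup>2)"
    by (intro sum_mono2) auto
  also have "\<dots> \<le> (real (card ?P) + (real (card ?P))\<^sup>2 * \<theta> ^ M) * real (card ?X)"
    using A(2) \<theta>(1) by (intro sum_norm_square_almost_orthogonal orth) (auto simp: g_def)
  also have "\<dots> \<le> (real (card A * p) + (real (card A * p))\<^sup>2 * \<theta> ^ M) * real (card ?X)"
    using \<theta>(1) by (intro mult_right_mono add_mono power_mono cP) auto
  also have "\<dots> = (real p / real (card A) + (real p)\<^sup>2 * \<theta> ^ M) * real (card S) ^ n * (real (card A))\<^sup>2"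
    using cA by (simp add: cX field_simps power2_eq_square)
  finally show ?thesis
    using cA by (simp add: mult_le_cancel_right)
qed

section \<open>Approximation of arbitrary families\<close>

text \<open>
  Here no character sum has any cancellation, but \<open>S ^ n\<close> is a point, so the satisfying set is empty or
  everything.
\<close>

lemma approximable_conditions_singleton_alphabet:
  assumes "card S = 1" "\<epsilon> \<ge> 0"
  shows "approximable n 1 \<epsilon> F"
proof (cases "sat n F = {}")
  case True
  then show ?thesis using assms by (intro approximable_if_sat_small) auto
next
  case False
  have "card ({..<n} \<rightarrow>\<^sub>E S) = 1" using assms(1) by (simp add: card_funcsetE)
  then obtain x where "{..<n} \<rightarrow>\<^sub>E S = {x}" by (auto simp: card_1_singleton_iff)
  with False have "sat n F = {..<n} \<rightarrow>\<^sub>E S" by (auto simp: sat_def)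
  then show ?thesis
    unfolding approximable_def using assms(2) by (intro exI[of _ "{}"]) (auto simp: sat_def)
qed

text \<open>
  The number \<open>R\<close> controls the diagonal and \<open>M\<close> the correlations in \<open>card_avoid_values_le\<close>, each up to
  \<open>\<epsilon> / 2\<close>. Both are chosen before \<open>n\<close> and the family are known. If the far-apart
  forms run out before \<open>R\<close> are found, every form is close to zero or to a multiple of one of them, which
  gives at most \<open>p R + 1\<close> centres and \<open>2 ^ p\<close> sets of values.
\<close>

theorem approximable_conditions:
  assumes "\<epsilon> > 0"
  shows "\<exists>K. \<forall>n F. F \<subseteq> conds n \<longrightarrow> approximable n K \<epsilon> F"
proof (cases "card S = 1")
  case True
  then show ?thesis using approximable_conditions_singleton_alphabet assms by (meson less_imp_le)
next
  case False
  then have S2: "card S \<ge> 2" using card_S_ge_1 by linarith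
  obtain \<theta> where \<theta>: "0 \<le> \<theta>" "\<theta> < 1"
    and bias: "\<And>a. \<not> int p dvd a \<Longrightarrow> norm (\<Sum>s\<in>S. add_char p (a * s)) \<le> \<theta> * real (card S)"
    using exists_add_char_bias_bound[OF prime_p S_subset S2] by blast
  obtain M where M: "(real p)\<^sup>2 * \<theta> ^ M \<le> \<epsilon> / 2"
    using exists_power_le[OF \<theta>, of "\<epsilon> / 2" "(real p)\<^sup>2"] assms by auto
  obtain R :: nat where R: "real R \<ge> 2 * real p / \<epsilon>"
    using real_arch_simple by blast
  have R0: "R > 0" using R assms p_pos by (metis divide_pos_pos gr0I mult_pos_pos not_le of_nat_0 of_nat_0_less_iff zero_less_numeral)
  have R': "real p / real R \<le> \<epsilon> / 2"
    using R R0 assms by (simp add: field_simps)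
  define k where "k = (p * R + 1) * 2 ^ p"
  have k: "k > 0" by (simp add: k_def)
  have "\<epsilon> / real k > 0" using assms k by simp
  from approximable_nearby_conditions[OF this] obtain K
    where K: "\<forall>n b E F. b \<in> coeffs n \<longrightarrow> E \<subseteq> {0..<int p} \<longrightarrow> F \<subseteq> coeffs n \<longrightarrow>
      (\<forall>a\<in>F. card (differing n a b) \<le> M) \<longrightarrow> approximable n K (\<epsilon> / real k) (F \<times> {E})" ..
  have "approximable n (1 + k * K) \<epsilon> F" if F: "F \<subseteq> conds n" for n F
  proof -
    \<comment> \<open>A form is useful in the first alternative only if its condition excludes some value.\<close>
    define F\<^sub>0 where "F\<^sub>0 = {f \<in> F. snd f \<noteq> {0..<int p}}"
    have "sat n F\<^sub>0 = sat n F"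
    proof -
      have mod_mem: "dot n a x mod int p \<in> {0..<int p}" for a x by simp
      show ?thesis by (auto simp: sat_def F\<^sub>0_def) (metis mod_mem)+
    qed
    \<comment> \<open>Forms with few nonzero coefficients are kept out of the greedy choice, since they are close to zero.\<close>
    define X where "X = {a \<in> fst ` F\<^sub>0. M \<le> card (differing n a (\<lambda>_. 0))}"
    have F\<^sub>0: "a \<in> coeffs n" "E \<subseteq> {0..<int p}" "E \<noteq> {0..<int p}" if "(a, E) \<in> F\<^sub>0" for a E
      using that F by (auto simp: F\<^sub>0_def conds_def)
    have X: "X \<subseteq> coeffs n" using F\<^sub>0(1) by (auto simp: X_def)
    have "approximable n (1 + k * K) \<epsilon> F\<^sub>0"
      using pairwise_subset_or_maximal[OF symp_far_apart, of X R n M]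
    proof (elim disjE exE conjE)
      fix A assume A: "A \<subseteq> X" "finite A" "card A = R" "pairwise (far_apart n M) A"
      have "\<exists>y. y \<in> {0..<int p} \<and> (\<forall>x\<in>sat n F\<^sub>0. dot n a x mod int p \<noteq> y)" if a: "a \<in> A" for a
      proof -
        obtain E where E: "(a, E) \<in> F\<^sub>0" using subsetD[OF A(1) a] by (auto simp: X_def)
        then obtain y where "y \<in> {0..<int p}" "y \<notin> E" using F\<^sub>0[OF E] by blast
        with E show ?thesis by (intro exI[of _ y]) (auto simp: sat_def)
      qed
      then obtain y where y: "\<And>a. a \<in> A \<Longrightarrow> y a \<in> {0..<int p}"
          "\<And>a x. a \<in> A \<Longrightarrow> x \<in> sat n F\<^sub>0 \<Longrightarrow> dot n a x mod int p \<noteq> y a" by metis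
      have sub: "sat n F\<^sub>0 \<subseteq> {x \<in> {..<n} \<rightarrow>\<^sub>E S. \<forall>a\<in>A. \<not> int p dvd dot n a x - y a}"
      proof (intro subsetI CollectI conjI ballI)
        fix x a assume x: "x \<in> sat n F\<^sub>0" and a: "a \<in> A"
        have "y a mod int p = y a" using y(1)[OF a] by simp
        with y(2)[OF a x] show "\<not> int p dvd dot n a x - y a" by (simp add: mod_eq_dvd_iff[symmetric])
      qed (auto simp: sat_def)
      have "real (card (sat n F\<^sub>0)) \<le> real (card {x \<in> {..<n} \<rightarrow>\<^sub>E S. \<forall>a\<in>A. \<not> int p dvd dot n a x - y a})"
        using sub by (intro of_nat_mono card_mono) auto
      also have "\<dots> \<le> (real p / real (card A) + (real p)\<^sup>2 * \<theta> ^ M) * real (card S) ^ n"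
        using A X \<theta> R0 by (intro card_avoid_values_le bias) (auto simp: X_def)
      also have "\<dots> \<le> \<epsilon> * real (card S) ^ n"
      proof (rule mult_right_mono)
        show "real p / real (card A) + (real p)\<^sup>2 * \<theta> ^ M \<le> \<epsilon>"
          using R' M unfolding A(3) by linarith
      qed simp
      finally show ?thesis by (rule approximable_mono[OF approximable_if_sat_small]) simp
    next
      fix A assume A: "A \<subseteq> X" "finite A" "card A < R" and max: "\<forall>a\<in>X. a \<in> A \<or> (\<exists>b\<in>A. \<not> far_apart n M a b)"
      define mult where "mult c b = (\<lambda>i\<in>{..<n}. c * b i mod int p)" for c and b :: "nat \<Rightarrow> int"
      define B where "B = insert (\<lambda>i\<in>{..<n}. 0) ((\<lambda>(c, b). mult c b) ` ({0..<int p} \<times> A))"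
      have finB: "finite B" using A(2) by (simp add: B_def)
      have "card B \<le> Suc (card ((\<lambda>(c, b). mult c b) ` ({0..<int p} \<times> A)))"
        unfolding B_def by (rule card_insert_le_m1) auto
      also have "\<dots> \<le> Suc (card ({0..<int p} \<times> A))"
        using A(2) by (intro Suc_le_mono[THEN iffD2] card_image_le) auto
      also have "\<dots> \<le> p * R + 1" using A(3) by (simp add: card_cartesian_product)
      finally have cB: "card B \<le> p * R + 1" .
      have B: "B \<subseteq> coeffs n" by (auto simp: B_def coeffs_def mult_def split: if_splits)
      have "\<exists>b. b \<in> B \<and> card (differing n a b) \<le> M" if a: "a \<in> fst ` F\<^sub>0" for a
      proof -
        have a_co: "a \<in> coeffs n" using a F\<^sub>0(1) by auto
        \<comment> \<open>Either \<open>a\<close> is close to zero, or it was chosen, or maximality makes it close to a multiple of a chosen form.\<close>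
        consider "a \<notin> X" | "a \<in> A" | b where "b \<in> A" "\<not> far_apart n M a b" using max by blast
        then show ?thesis
        proof cases
          case 1
          have "differing n a (\<lambda>i\<in>{..<n}. 0) = differing n a (\<lambda>_. 0)" by (auto simp: differing_def)
          with 1 a show ?thesis by (intro exI[of _ "\<lambda>i\<in>{..<n}. 0"]) (auto simp: X_def B_def)
        next
          case 2
          have "differing n a (mult 1 a) = {}" using coeffs_mem[OF a_co] by (auto simp: differing_def mult_def)
          with 2 p_gt_1 show ?thesis by (intro exI[of _ "mult 1 a"]) (auto simp: B_def)
        next
          case (3 b)
          then obtain c where "c \<in> {0..<int p}" "card (differing n a (mult c b)) \<le> M"
            unfolding mult_def using near_multiple_if_not_far_apart[OF a_co] by blast
          with 3(1) show ?thesis by (intro exI[of _ "mult c b"]) (auto simp: B_def)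
        qed
      qed
      then obtain \<beta> where \<beta>: "\<And>a. a \<in> fst ` F\<^sub>0 \<Longrightarrow> \<beta> a \<in> B \<and> card (differing n a (\<beta> a)) \<le> M" by metis
      have "approximable n (k * K) \<epsilon> F\<^sub>0"
      proof (rule approximable_partition[of "B \<times> Pow {0..<int p}" k "\<lambda>(a, E). (\<beta> a, E)"])
        have "card (B \<times> Pow {0..<int p}) = card B * 2 ^ p" by (simp add: card_cartesian_product card_Pow)
        also have "\<dots> \<le> k" unfolding k_def using cB by (rule mult_le_mono1)
        finally show "card (B \<times> Pow {0..<int p}) \<le> k" .
        fix c assume c: "c \<in> B \<times> Pow {0..<int p}"
        obtain b E where bE: "c = (b, E)" by (cases c)
        have "{f \<in> F\<^sub>0. (case f of (a, E) \<Rightarrow> (\<beta> a, E)) = c} = {a. (a, E) \<in> F\<^sub>0 \<and> \<beta> a = b} \<times> {E}"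
          by (auto simp: bE)
        moreover have "approximable n K (\<epsilon> / real k) ({a. (a, E) \<in> F\<^sub>0 \<and> \<beta> a = b} \<times> {E})"
          using c bE B F\<^sub>0(1) \<beta> by (intro K[rule_format]) force+
        ultimately show "approximable n K (\<epsilon> / real k) {f \<in> F\<^sub>0. (case f of (a, E) \<Rightarrow> (\<beta> a, E)) = c}" by simp
      next
        show "(\<lambda>(a, E). (\<beta> a, E)) ` F\<^sub>0 \<subseteq> B \<times> Pow {0..<int p}"
          using \<beta> F\<^sub>0(2) by force
      qed (use finB k assms in auto)
      then show ?thesis by (rule approximable_mono) simp
    qed
    then show ?thesis unfolding approximable_def \<open>sat n F\<^sub>0 = sat n F\<close> .
  qed
  then show ?thesis by blast
qed

end

section \<open>Linear forms and their coefficients\<close>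

lemma linear_form_dot:
  fixes p :: nat assumes "p > 0"
  shows "linear_form (GFp p) n (\<lambda>x. dot n a x mod int p)"
proof -
  have "dot n a (\<lambda>i\<in>{..<n}. (x i + y i) mod int p) mod int p = (dot n a x mod int p + dot n a y mod int p) mod int p" for x y
  proof -
    have "dot n a (\<lambda>i\<in>{..<n}. (x i + y i) mod int p) mod int p = (\<Sum>i<n. a i * (x i + y i)) mod int p"
      unfolding dot_def by (subst (1 2) mod_sum_eq[symmetric]) (simp add: mod_mult_right_eq)
    also have "(\<Sum>i<n. a i * (x i + y i)) = dot n a x + dot n a y"
      by (simp add: dot_def sum.distrib distrib_left)
    also have "(dot n a x + dot n a y) mod int p = (dot n a x mod int p + dot n a y mod int p) mod int p"
      by (simp add: mod_add_eq)
    finally show ?thesis .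
  qed
  moreover have "dot n a (\<lambda>i\<in>{..<n}. c * x i mod int p) mod int p = c * (dot n a x mod int p) mod int p" for c x
  proof -
    have "dot n a (\<lambda>i\<in>{..<n}. c * x i mod int p) mod int p = (\<Sum>i<n. a i * (c * x i)) mod int p"
      unfolding dot_def by (subst (1 2) mod_sum_eq[symmetric]) (simp add: mod_mult_right_eq)
    also have "(\<Sum>i<n. a i * (c * x i)) = c * dot n a x"
      by (simp add: dot_def sum_distrib_left ac_simps)
    also have "c * dot n a x mod int p = c * (dot n a x mod int p) mod int p"
      by (simp add: mod_mult_right_eq)
    finally show ?thesis .
  qed
  ultimately show ?thesis
    using assms by (auto simp: linear_form_def residue_ring_def)
qed

text \<open>
  The coefficients are the values at the unit vectors. Additivity is stated only for two summands, so
  the coordinates of \<open>x\<close> are switched on one after the other.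
\<close>

lemma linear_form_eq_dot:
  fixes p :: nat assumes p: "p > 1" and lin: "linear_form (GFp p) n \<psi>"
  obtains a where "a \<in> {..<n} \<rightarrow>\<^sub>E {0..<int p}"
    "\<And>x. x \<in> {..<n} \<rightarrow>\<^sub>E {0..<int p} \<Longrightarrow> \<psi> x = dot n a x mod int p"
proof -
  let ?C = "{..<n} \<rightarrow>\<^sub>E {0..<int p}"
  have car: "carrier (GFp p) = {0..<int p}" by (auto simp: residue_ring_def)
  have in_C: "\<psi> x \<in> {0..<int p}" if "x \<in> ?C" for x
    using lin that car unfolding linear_form_def by auto
  have add: "\<psi> (\<lambda>i\<in>{..<n}. (x i + y i) mod int p) = (\<psi> x + \<psi> y) mod int p" if "x \<in> ?C" "y \<in> ?C" for x y
    using lin that unfolding linear_form_def car by (simp add: residue_ring_def)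
  have scale: "\<psi> (\<lambda>i\<in>{..<n}. (c * x i) mod int p) = (c * \<psi> x) mod int p" if "c \<in> {0..<int p}" "x \<in> ?C" for c x
    using lin that unfolding linear_form_def car by (simp add: residue_ring_def)
  define e where "e k = (\<lambda>i\<in>{..<n}. if i = k then 1 else 0 :: int)" for k
  have e: "e k \<in> ?C" for k using p by (auto simp: e_def)
  define a where "a = (\<lambda>k\<in>{..<n}. \<psi> (e k))"
  have "\<psi> x = dot n a x mod int p" if x: "x \<in> ?C" for x
  proof -
    have xi: "x i \<in> {0..<int p}" if "i < n" for i using PiE_mem[OF x, of i] that by simp
    define t where "t k = (\<lambda>i\<in>{..<n}. if i < k then x i else 0)" for k
    have t: "t k \<in> ?C" for k using xi p by (auto simp: t_def)
    have "\<psi> (t k) = (\<Sum>i<k. a i * x i) mod int p" if "k \<le> n" for k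
      using that
    proof (induction k)
      case 0
      have "(\<lambda>i\<in>{..<n}. (0 * x i) mod int p) = t 0" by (auto simp: t_def)
      with scale[of 0 x] x p show ?case by simp
    next
      case (Suc k)
      define u where "u = (\<lambda>i\<in>{..<n}. (x k * e k i) mod int p)"
      have "t (Suc k) = (\<lambda>i\<in>{..<n}. (t k i + u i) mod int p)"
      proof
        fix i
        show "t (Suc k) i = (\<lambda>i\<in>{..<n}. (t k i + u i) mod int p) i"
          using xi[of i] xi[of k] Suc.prems by (cases "i = k") (auto simp: t_def e_def u_def less_Suc_eq)
      qed
      moreover have "u \<in> ?C" using p by (auto simp: u_def)
      moreover have "\<psi> u = (x k * \<psi> (e k)) mod int p"
        unfolding u_def using Suc.prems by (intro scale xi e) simp
      ultimately have "\<psi> (t (Suc k)) = (\<psi> (t k) + (x k * \<psi> (e k)) mod int p) mod int p"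
        using add[OF t[of k], of u] by simp
      also have "\<dots> = (\<Sum>i<Suc k. a i * x i) mod int p"
        using Suc by (simp add: a_def mod_add_eq mult.commute)
      finally show ?case .
    qed
    from this[of n] have "\<psi> (t n) = dot n a x mod int p" by (simp add: dot_def)
    moreover have "t n = x" using x by (auto simp: t_def fun_eq_iff PiE_iff extensional_def)
    ultimately show ?thesis by simp
  qed
  moreover have "a \<in> ?C" using in_C e by (auto simp: a_def)
  ultimately show ?thesis by (rule that[rotated])
qed

theorem theorem1p2:
  fixes \<epsilon> :: real and p :: nat and S :: "int set"
  assumes "\<epsilon> > 0" and "prime p" and "S \<subseteq> carrier (GFp p)" and "S \<noteq> {}"
  shows "\<exists>K::nat. \<forall>n::nat. n > 0 \<longrightarrow>
           (\<forall>F. F \<subseteq> mod_p_conditions p S n \<longrightarrow>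
             (\<exists>G. G \<subseteq> mod_p_conditions p S n \<and> finite G \<and> card G \<le> K \<and>
                  internally_approximates S n \<epsilon> G F))"
proof -
  have car: "carrier (GFp p) = {0..<int p}" by (auto simp: residue_ring_def)
  interpret prime_alphabet p S
    using assms car by unfold_locales auto
  obtain K where K: "\<forall>n F. F \<subseteq> conds n \<longrightarrow> approximable n K \<epsilon> F"
    using approximable_conditions[OF assms(1)] ..
  have "\<exists>G. G \<subseteq> mod_p_conditions p S n \<and> finite G \<and> card G \<le> K \<and> internally_approximates S n \<epsilon> G F"
    if F: "F \<subseteq> mod_p_conditions p S n" for n F
  proof -
    define \<Phi> where "\<Phi> = (\<lambda>(a, E). (restrict (\<lambda>x. dot n a x mod int p) (set_power S n), E :: int set))"
    have sat_eq: "satisfying_set S n (\<Phi> ` H) = sat n H" for H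
      by (fastforce simp: satisfying_set_def satisfies_def sat_def \<Phi>_def)
    have "mod_p_conditions p S n \<subseteq> \<Phi> ` conds n"
    proof
      fix f assume "f \<in> mod_p_conditions p S n"
      then obtain \<psi> E where f: "f = (restrict \<psi> (set_power S n), E)" "linear_form (GFp p) n \<psi>" "E \<subseteq> {0..<int p}"
        unfolding mod_p_conditions_def car by blast
      obtain a where a: "a \<in> {..<n} \<rightarrow>\<^sub>E {0..<int p}"
          "\<And>x. x \<in> {..<n} \<rightarrow>\<^sub>E {0..<int p} \<Longrightarrow> \<psi> x = dot n a x mod int p"
        using linear_form_eq_dot[OF p_gt_1 f(2)] by blast
      have "set_power S n \<subseteq> {..<n} \<rightarrow>\<^sub>E {0..<int p}" using S_subset by (intro PiE_mono) auto
      then have "restrict \<psi> (set_power S n) = restrict (\<lambda>x. dot n a x mod int p) (set_power S n)"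
        using a(2) by (intro restrict_ext) auto
      with a(1) f(1,3) show "f \<in> \<Phi> ` conds n"
        by (intro image_eqI[of _ _ "(a, E)"]) (auto simp: \<Phi>_def conds_def coeffs_def)
    qed
    with F obtain F' where F': "F' \<subseteq> conds n" "F = \<Phi> ` F'"
      by (meson order_trans subset_imageE)
    have "approximable n K \<epsilon> F'" using K F'(1) by simp
    then obtain G where G: "G \<subseteq> conds n" "finite G" "card G \<le> K" "sat n G \<subseteq> sat n F'"
        "real (card (sat n F' - sat n G)) \<le> \<epsilon> * real (card S) ^ n"
      unfolding approximable_def by (elim exE conjE)
    have "\<Phi> (a, E) \<in> mod_p_conditions p S n" if "(a, E) \<in> conds n" for a E
      using that linear_form_dot[OF p_pos] unfolding mod_p_conditions_def car \<Phi>_def conds_def by auto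
    then have "\<Phi> ` G \<subseteq> mod_p_conditions p S n" using G(1) by auto
    moreover have "card (\<Phi> ` G) \<le> K" using card_image_le[OF G(2), of \<Phi>] G(3) by simp
    moreover have "internally_approximates S n \<epsilon> (\<Phi> ` G) F"
      using G(4,5) unfolding internally_approximates_def F'(2) sat_eq by (simp add: card_funcsetE)
    ultimately show ?thesis using G(2) by blast
  qed
  then show ?thesis by blast
qed

end
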